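(* Let $G$ be a finite abelian group of order $n$ with exponent $\exp(G)$, let $k<n$ with $\exp(G)\mid k$, and let $x\in G$. Then: (i) if $(G,\mathcal{B}_k^x)$ is a $t$-design for some $t\ge 2$, then $(G^*,\mathcal{B}_k^{x,*})$ is a $(t-1)$-design; (ii) conversely, if $t\ge 2$ and both $(G^*,\mathcal{B}_k^{x,*})$ and $(G,\mathcal{B}_k^x)$ are $(t-1)$-designs, then $(G,\mathcal{B}_k^x)$ is a $t$-design.
   Context: $G^*=G\setminus\{0\}$. $\mathcal{B}_k^x$ is the family of all $k$-subsets of $G$ whose elements sum to $x$, and $\mathcal{B}_k^{x,*}$ is the family of all $k$-subsets of $G^*$ whose elements sum to $x$. A pair $(\mathcal{P},\mathcal{B})$ with $\mathcal{B}$ a family of distinct $k$-subsets of $\mathcal{P}$ is a $t$-design if every $t$-subset of $\mathcal{P}$ is contained in the same number of members of $\mathcal{B}$.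
   Formalization: Part (i) is stated for all t ≥ 2 except t = k+1, where every family of k-subsets is vacuously a t-design and the claim fails (e.g. G = Z_2^2, k = 2, x ≠ 0, t = 3). *)

theory Defs
  imports "HOL-Algebra.Algebra"
begin

text \<open>Abelian groups are written multiplicatively, following the library locale
  \<^locale>\<open>comm_group\<close>: the neutral element \<open>\<one>\<close> plays the role of \<open>0\<close>, the sum of
  the elements of a subset \<open>B\<close> is \<open>\<Otimes>b\<in>B. b\<close>, and \<open>G - {\<one>}\<close> is \<open>G\<^sup>*\<close>.\<close>

definition group_exponent :: "('a, 'b) monoid_scheme \<Rightarrow> nat" where
  "group_exponent G = (LEAST e. 0 < e \<and> (\<forall>g\<in>carrier G. g [^]\<^bsub>G\<^esub> e = \<one>\<^bsub>G\<^esub>))"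

definition sum_blocks :: "('a, 'b) monoid_scheme \<Rightarrow> nat \<Rightarrow> 'a \<Rightarrow> 'a set set" where
  "sum_blocks G k x =
     {B. B \<subseteq> carrier G \<and> card B = k \<and> (\<Otimes>\<^bsub>G\<^esub>b\<in>B. b) = x}"

definition sum_blocks_star :: "('a, 'b) monoid_scheme \<Rightarrow> nat \<Rightarrow> 'a \<Rightarrow> 'a set set" where
  "sum_blocks_star G k x =
     {B. B \<subseteq> carrier G - {\<one>\<^bsub>G\<^esub>} \<and> card B = k \<and> (\<Otimes>\<^bsub>G\<^esub>b\<in>B. b) = x}"

text \<open>The common number \<open>l\<close> of blocks may be \<open>0\<close>, and no relation between \<open>t\<close> and \<open>k\<close> is
  required.\<close>

definition t_design :: "nat \<Rightarrow> nat \<Rightarrow> 'a set \<Rightarrow> 'a set set \<Rightarrow> bool" where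
  "t_design t k P \<B> \<longleftrightarrow>
     finite P \<and>
     (\<forall>B\<in>\<B>. B \<subseteq> P \<and> card B = k) \<and>
     (\<exists>l. \<forall>T. T \<subseteq> P \<and> card T = t \<longrightarrow> card {B \<in> \<B>. T \<subseteq> B} = l)"

end

theory Submission
  imports Defs
begin

text \<open>Since the exponent divides \<open>k\<close>, translations of \<open>G\<close> permute \<open>sum_blocks G k x\<close>, so every
  \<open>t\<close>-subset may be assumed to contain the neutral element.  The blocks through
  \<open>T \<subseteq> G\<^sup>*\<close> split into those that avoid the neutral element, which are the blocks
  of \<open>sum_blocks_star G k x\<close> through \<open>T\<close>, and those that contain it, which are the blocks through
  \<open>T \<union> {0}\<close>.\<close>

section \<open>Translations acting on blocks\<close>

lemma (in group) pow_eq_one_if_exponent_dvd: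
  assumes fin: "finite (carrier G)" and dvd: "group_exponent G dvd k" and g: "g \<in> carrier G"
  shows "g [^] k = \<one>"
proof -
  \<comment> \<open>The group order is a positive candidate, so the \<open>LEAST\<close> in
    \<open>group_exponent\<close> is attained.\<close>
  have "0 < order G \<and> (\<forall>g\<in>carrier G. g [^] order G = \<one>)"
    using fin pow_order_eq_1 order_gt_0_iff_finite by blast
  then have "g [^] group_exponent G = \<one>"
    unfolding group_exponent_def
    using LeastI[of "\<lambda>e. 0 < e \<and> (\<forall>g\<in>carrier G. g [^] e = \<one>)" "order G"] g by blast
  moreover obtain m where "k = group_exponent G * m"
    using dvd by (elim dvdE)
  ultimately show ?thesis
    using g by (metis nat_pow_pow nat_pow_one)
qed

text \<open>Translating by \<open>g\<close> multiplies the product over a block by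
  \<open>g [^] k\<close>, and this power is trivial because the exponent divides
  \<open>k\<close>.\<close>

lemma (in comm_group) sum_blocks_translate:
  assumes fin: "finite (carrier G)" and dvd: "group_exponent G dvd k" and g: "g \<in> carrier G"
    and B: "B \<in> sum_blocks G k x"
  shows "(\<otimes>) g ` B \<in> sum_blocks G k x"
proof -
  have sub: "B \<subseteq> carrier G" and card: "card B = k" and prod: "(\<Otimes>b\<in>B. b) = x"
    using B by (auto simp: sum_blocks_def)
  have inj: "inj_on ((\<otimes>) g) B"
    using inj_on_cmult[OF g] sub by (rule inj_on_subset)
  have "(\<Otimes>c\<in>(\<otimes>) g ` B. c) = (\<Otimes>b\<in>B. g \<otimes> b)"
    using sub g inj by (subst finprod_reindex) auto
  also have "\<dots> = (\<Otimes>b\<in>B. g) \<otimes> (\<Otimes>b\<in>B. b)"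
    using sub g by (intro finprod_multf) auto
  also have "(\<Otimes>b\<in>B. g) = \<one>"
    using pow_eq_one_if_exponent_dvd[OF fin dvd g] card g by (simp add: finprod_const)
  also have "\<one> \<otimes> (\<Otimes>b\<in>B. b) = x"
    using sub by (subst l_one) (auto simp: prod[symmetric] intro!: finprod_closed)
  finally show ?thesis
    using sub g card inj by (auto simp: sum_blocks_def card_image)
qed

lemma finite_sum_blocks: "finite (carrier G) \<Longrightarrow> finite (sum_blocks G k x)"
  by (rule finite_subset[of _ "Pow (carrier G)"]) (auto simp: sum_blocks_def)

text \<open>Translation by \<open>g\<close> maps the blocks through \<open>T\<close> injectively to
  blocks through the translate. An inequality is enough, since applying it to \<open>inv g\<close>
  reverses it.\<close>

lemma (in comm_group) card_sum_blocks_translate_le: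
  assumes fin: "finite (carrier G)" and dvd: "group_exponent G dvd k" and g: "g \<in> carrier G"
  shows "card {B \<in> sum_blocks G k x. T \<subseteq> B}
    \<le> card {B \<in> sum_blocks G k x. (\<otimes>) g ` T \<subseteq> B}"
proof (rule card_inj_on_le[where f = "image ((\<otimes>) g)"])
  show "inj_on (image ((\<otimes>) g)) {B \<in> sum_blocks G k x. T \<subseteq> B}"
    using inj_on_image_Pow[OF inj_on_cmult[OF g]]
    by (rule inj_on_subset) (auto simp: sum_blocks_def)
  show "(`) ((\<otimes>) g) ` {B \<in> sum_blocks G k x. T \<subseteq> B}
    \<subseteq> {B \<in> sum_blocks G k x. (\<otimes>) g ` T \<subseteq> B}"
    using sum_blocks_translate[OF fin dvd g] by blast
  show "finite {B \<in> sum_blocks G k x. (\<otimes>) g ` T \<subseteq> B}"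
    using finite_sum_blocks[OF fin] by simp
qed

lemma (in comm_group) card_sum_blocks_translate:
  assumes fin: "finite (carrier G)" and dvd: "group_exponent G dvd k" and g: "g \<in> carrier G"
    and T: "T \<subseteq> carrier G"
  shows "card {B \<in> sum_blocks G k x. (\<otimes>) g ` T \<subseteq> B} = card {B \<in> sum_blocks G k x. T \<subseteq> B}"
proof (rule antisym[OF _ card_sum_blocks_translate_le[OF fin dvd g]])
  \<comment> \<open>Translating back recovers \<open>T\<close>, so the bound for
    \<open>inv g\<close> is the missing inequality.\<close>
  have "inv g \<otimes> (g \<otimes> y) = y" if "y \<in> T" for y
    using that T g by (metis m_assoc l_inv l_one inv_closed subsetD)
  then have "(\<otimes>) (inv g) ` (\<otimes>) g ` T = T"
    by (simp add: image_image)
  then show "card {B \<in> sum_blocks G k x. (\<otimes>) g ` T \<subseteq> B} \<le> card {B \<in> sum_blocks G k x. T \<subseteq> B}"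
    using card_sum_blocks_translate_le[OF fin dvd inv_closed[OF g], of x "(\<otimes>) g ` T"] by simp
qed

section \<open>Counting blocks: splitting at the neutral element and double counting\<close>

lemma card_sum_blocks_split:
  assumes fin: "finite (carrier G)"
  shows "card {B \<in> sum_blocks G k x. T \<subseteq> B} =
    card {B \<in> sum_blocks_star G k x. T \<subseteq> B} +
    card {B \<in> sum_blocks G k x. insert \<one>\<^bsub>G\<^esub> T \<subseteq> B}"
proof -
  have split: "{B \<in> sum_blocks G k x. T \<subseteq> B} =
    {B \<in> sum_blocks_star G k x. T \<subseteq> B} \<union> {B \<in> sum_blocks G k x. insert \<one>\<^bsub>G\<^esub> T \<subseteq> B}"
    by (auto simp: sum_blocks_def sum_blocks_star_def)
  have "sum_blocks_star G k x \<subseteq> sum_blocks G k x"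
    by (auto simp: sum_blocks_def sum_blocks_star_def)
  then have finite: "finite (sum_blocks_star G k x)" "finite (sum_blocks G k x)"
    using finite_sum_blocks[OF fin] by (auto intro: finite_subset)
  have "{B \<in> sum_blocks_star G k x. T \<subseteq> B} \<inter>
    {B \<in> sum_blocks G k x. insert \<one>\<^bsub>G\<^esub> T \<subseteq> B} = {}"
    by (auto simp: sum_blocks_star_def)
  then show ?thesis
    unfolding split using finite by (simp add: card_Un_disjoint)
qed

text \<open>Double counting of the pairs \<open>(p, B)\<close> with \<open>p\<close> outside
  \<open>S\<close> and \<open>B\<close> a block through \<open>insert p S\<close>. If some block
  contains \<open>S\<close>, then \<open>card S \<le> k\<close> and the subtraction is exact;
  otherwise both sides vanish.\<close>

lemma sum_card_blocks_insert:
  assumes fin: "finite P" and blocks: "\<And>B. B \<in> \<B> \<Longrightarrow> B \<subseteq> P \<and> card B = k" and S: "S \<subseteq> P"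
  shows "(\<Sum>p\<in>P - S. card {B \<in> \<B>. insert p S \<subseteq> B}) = (k - card S) * card {B \<in> \<B>. S \<subseteq> B}"
proof -
  let ?I = "{B \<in> \<B>. S \<subseteq> B}"
  have "finite \<B>"
    using blocks fin by (intro finite_subset[of \<B> "Pow P"]) auto
  then have finI: "finite ?I"
    by simp
  have "{B \<in> \<B>. insert p S \<subseteq> B} = {B \<in> ?I. p \<in> B}" for p
    by auto
  then have "(\<Sum>p\<in>P - S. card {B \<in> \<B>. insert p S \<subseteq> B}) = (\<Sum>p\<in>P - S. card {B \<in> ?I. p \<in> B})"
    by simp
  also have "\<dots> = (k - card S) * card ?I"
  proof (rule sum_multicount)
    show "\<forall>B\<in>?I. card {p \<in> P - S. p \<in> B} = k - card S"
    proof
      fix B assume "B \<in> ?I"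
      then have "B \<subseteq> P" "card B = k" "S \<subseteq> B"
        using blocks by auto
      moreover from this have "{p \<in> P - S. p \<in> B} = B - S"
        by auto
      ultimately show "card {p \<in> P - S. p \<in> B} = k - card S"
        using S fin by (simp add: card_Diff_subset finite_subset)
    qed
  qed (use fin finI in auto)
  finally show ?thesis .
qed

section \<open>Raising and lowering the strength of a design\<close>

lemma t_designD:
  assumes "t_design t k P \<B>"
  shows "finite P" "B \<in> \<B> \<Longrightarrow> B \<subseteq> P \<and> card B = k"
    and "\<exists>l. \<forall>T. T \<subseteq> P \<longrightarrow> card T = t \<longrightarrow> card {B \<in> \<B>. T \<subseteq> B} = l"
  using assms unfolding t_design_def by simp_all metis

lemma t_designI:
  assumes "finite P" "\<And>B. B \<in> \<B> \<Longrightarrow> B \<subseteq> P \<and> card B = k"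
    "\<And>T. T \<subseteq> P \<Longrightarrow> card T = t \<Longrightarrow> card {B \<in> \<B>. T \<subseteq> B} = l"
  shows "t_design t k P \<B>"
  unfolding t_design_def using assms by (intro conjI ballI exI[of _ l]) simp_all

text \<open>For \<open>s < k\<close> double counting determines the number of blocks through an
  \<open>s\<close>-set; for \<open>s > k\<close> there are none. At \<open>s = k\<close> the
  assumption holds for any family of \<open>k\<close>-sets, with count 0, and says nothing about
  which \<open>k\<close>-sets are blocks.\<close>

lemma t_design_pred:
  assumes design: "t_design (Suc s) k P \<B>" and neq: "s \<noteq> k"
  shows "t_design s k P \<B>"
proof -
  note fin = t_designD(1)[OF design] and blocks = t_designD(2)[OF design]
  obtain l where l: "\<forall>T. T \<subseteq> P \<longrightarrow> card T = Suc s \<longrightarrow> card {B \<in> \<B>. T \<subseteq> B} = l"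
    using t_designD(3)[OF design] ..
  \<comment> \<open>For \<open>s > k\<close> the divisor \<open>k - s\<close> is 0 and the quotient
    is 0 by convention, so one formula serves both cases.\<close>
  have "card {B \<in> \<B>. S \<subseteq> B} = (card P - s) * l div (k - s)" if S: "S \<subseteq> P" "card S = s" for S
  proof (cases "s < k")
    case True
    have finS: "finite S"
      using S fin finite_subset by blast
    have "(k - s) * card {B \<in> \<B>. S \<subseteq> B} = (\<Sum>p\<in>P - S. card {B \<in> \<B>. insert p S \<subseteq> B})"
      using sum_card_blocks_insert[OF fin blocks S(1)] S(2) by simp
    also have "\<dots> = (\<Sum>p\<in>P - S. l)"
      using S finS by (intro sum.cong refl l[rule_format]) auto
    also have "\<dots> = (card P - s) * l"
      using S finS by (simp add: card_Diff_subset)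
    finally have "(card P - s) * l = (k - s) * card {B \<in> \<B>. S \<subseteq> B}" ..
    with True show ?thesis
      by simp
  next
    case False
    have "\<not> S \<subseteq> B" if "B \<in> \<B>" for B
    proof
      assume "S \<subseteq> B"
      moreover have "finite B" "card B = k"
        using blocks[OF that] fin by (auto intro: finite_subset)
      ultimately have "s \<le> k"
        using card_mono S(2) by blast
      with False neq show False
        by simp
    qed
    then have "card {B \<in> \<B>. S \<subseteq> B} = 0"
      by (metis (no_types, lifting) Collect_empty_eq card.empty)
    with False show ?thesis
      by simp
  qed
  with fin blocks show ?thesis
    by (rule t_designI)
qed

text \<open>Splitting at the neutral element expresses the number of star blocks through
  \<open>T\<close> by the counts for \<open>T\<close> and \<open>insert \<one> T\<close> in the full
  family. The first is constant by \<open>t_design_pred\<close>, the second by assumption.\<close>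

lemma (in comm_group) t_design_star:
  assumes fin: "finite (carrier G)"
    and design: "t_design (Suc s) k (carrier G) (sum_blocks G k x)" and neq: "s \<noteq> k"
  shows "t_design s k (carrier G - {\<one>}) (sum_blocks_star G k x)"
proof -
  obtain l where
    l: "\<forall>T. T \<subseteq> carrier G \<longrightarrow> card T = Suc s \<longrightarrow> card {B \<in> sum_blocks G k x. T \<subseteq> B} = l"
    using t_designD(3)[OF design] ..
  obtain m where
    m: "\<forall>T. T \<subseteq> carrier G \<longrightarrow> card T = s \<longrightarrow> card {B \<in> sum_blocks G k x. T \<subseteq> B} = m"
    using t_designD(3)[OF t_design_pred[OF design neq]] ..
  have "card {B \<in> sum_blocks_star G k x. T \<subseteq> B} = m - l"
    if T: "T \<subseteq> carrier G - {\<one>}" "card T = s" for T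
  proof -
    have "finite T" "\<one> \<notin> T"
      using T(1) fin by (auto intro: finite_subset)
    then have "card (insert \<one> T) = Suc s"
      using T(2) by simp
    then have "card {B \<in> sum_blocks G k x. insert \<one> T \<subseteq> B} = l"
      using T by (intro l[rule_format]) auto
    moreover have "card {B \<in> sum_blocks G k x. T \<subseteq> B} = m"
      using T by (intro m[rule_format]) auto
    ultimately show ?thesis
      using card_sum_blocks_split[OF fin, of k x T] by simp
  qed
  with fin show ?thesis
    by (intro t_designI[where l = "m - l"]) (auto simp: sum_blocks_star_def)
qed

text \<open>The same splitting is now solved for the blocks through \<open>insert \<one> T\<close>.
  This settles the sets containing the neutral element, and translation reduces every other set to
  these.\<close>

lemma (in comm_group) t_design_Suc:
  assumes fin: "finite (carrier G)" and dvd: "group_exponent G dvd k"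
    and star: "t_design s k (carrier G - {\<one>}) (sum_blocks_star G k x)"
    and design: "t_design s k (carrier G) (sum_blocks G k x)"
  shows "t_design (Suc s) k (carrier G) (sum_blocks G k x)"
proof -
  obtain l where
    l: "\<forall>T. T \<subseteq> carrier G - {\<one>} \<longrightarrow> card T = s \<longrightarrow> card {B \<in> sum_blocks_star G k x. T \<subseteq> B} = l"
    using t_designD(3)[OF star] ..
  obtain m where
    m: "\<forall>T. T \<subseteq> carrier G \<longrightarrow> card T = s \<longrightarrow> card {B \<in> sum_blocks G k x. T \<subseteq> B} = m"
    using t_designD(3)[OF design] ..
  have "card {B \<in> sum_blocks G k x. T \<subseteq> B} = m - l"
    if T: "T \<subseteq> carrier G" "card T = Suc s" for T
  proof -
    from T(2) obtain g where gT: "g \<in> T"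
      by fastforce
    with T have g: "g \<in> carrier G"
      by blast
    \<comment> \<open>Translating by the inverse of a chosen element of \<open>T\<close> moves that
      element to \<open>\<one>\<close>.\<close>
    let ?U = "(\<otimes>) (inv g) ` T"
    have U: "?U \<subseteq> carrier G"
      using T g by auto
    have one: "\<one> \<in> ?U"
      using gT g by (metis image_eqI l_inv)
    have "card ?U = Suc s"
      using T inj_on_subset[OF inj_on_cmult[OF inv_closed[OF g]]] by (simp add: card_image)
    \<comment> \<open>Without \<open>\<one>\<close> the translate is an \<open>s\<close>-subset
      avoiding the neutral element, so both assumed designs apply to it.\<close>
    then have card: "card (?U - {\<one>}) = s"
      using one by simp
    have "card {B \<in> sum_blocks G k x. T \<subseteq> B} = card {B \<in> sum_blocks G k x. ?U \<subseteq> B}"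
      using card_sum_blocks_translate[OF fin dvd _ T(1)] g by simp
    also have "\<dots> = card {B \<in> sum_blocks G k x. insert \<one> (?U - {\<one>}) \<subseteq> B}"
      using one by (simp add: insert_absorb)
    also have "\<dots> = m - l"
    proof -
      have "?U - {\<one>} \<subseteq> carrier G - {\<one>}" "?U - {\<one>} \<subseteq> carrier G"
        using U by auto
      then show ?thesis
        using card_sum_blocks_split[OF fin, of k x "?U - {\<one>}"]
          l[rule_format, OF _ card] m[rule_format, OF _ card] by simp
    qed
    finally show ?thesis .
  qed
  with fin show ?thesis
    by (intro t_designI[where l = "m - l"]) (auto simp: sum_blocks_def)
qed

text \<open>The case \<open>t = k + 1\<close> is excluded from the first implication because its
  premise is then vacuous: no block contains \<open>k + 1\<close> points. The conclusion can fail
  there. In the Klein four-group with \<open>k = 2\<close> and \<open>x\<close> not neutral, exactly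
  one of the three pairs of non-neutral elements has product \<open>x\<close>.\<close>

theorem theorem6:
  fixes G :: "('a, 'b) monoid_scheme" and n k :: nat and x :: 'a
  assumes "comm_group G"
    and "finite (carrier G)"
    and "order G = n"
    and "k < n"
    and "group_exponent G dvd k"
    and "x \<in> carrier G"
  shows "(\<forall>t\<ge>2. t \<noteq> k + 1 \<longrightarrow>
            t_design t k (carrier G) (sum_blocks G k x) \<longrightarrow>
            t_design (t - 1) k (carrier G - {\<one>\<^bsub>G\<^esub>}) (sum_blocks_star G k x))
       \<and> (\<forall>t\<ge>2.
            t_design (t - 1) k (carrier G - {\<one>\<^bsub>G\<^esub>}) (sum_blocks_star G k x) \<longrightarrow>
            t_design (t - 1) k (carrier G) (sum_blocks G k x) \<longrightarrow>
            t_design t k (carrier G) (sum_blocks G k x))"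
proof -
  interpret comm_group G by fact
  show ?thesis
  proof (intro conjI allI impI)
    fix t :: nat
    assume "2 \<le> t" "t \<noteq> k + 1" "t_design t k (carrier G) (sum_blocks G k x)"
    then show "t_design (t - 1) k (carrier G - {\<one>\<^bsub>G\<^esub>}) (sum_blocks_star G k x)"
      using t_design_star[OF assms(2), of "t - 1" k x] by simp
  next
    fix t :: nat
    assume "2 \<le> t" "t_design (t - 1) k (carrier G - {\<one>\<^bsub>G\<^esub>}) (sum_blocks_star G k x)"
      "t_design (t - 1) k (carrier G) (sum_blocks G k x)"
    then show "t_design t k (carrier G) (sum_blocks G k x)"
      using t_design_Suc[OF assms(2,5), of "t - 1" x] by simp
  qed
qed

end
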